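(* Let $f\colon A\to B$ be a homomorphism of commutative rings with $1\neq0$, let $J$ be an ideal of $B$, and let $A\bowtie^f J=\{(a,f(a)+j): a\in A,\ j\in J\}$ (a subring of $A\times B$) be the amalgamated algebra along $J$. For a multiplicative set $S\subseteq A$, define $S'=\{(s,f(s)): s\in S\}\cup\{(1,1)\}\subseteq A\bowtie^f J$. Then $S'$ is a strongly multiplicative set of $A\bowtie^f J$ if and only if $S$ is a strongly multiplicative set of $A$.
   Context: A multiplicative set $S$ of a commutative ring $R$ is a subset with $0\notin S$, $1\in S$, and $st\in S$ for all $s,t\in S$. It is strongly multiplicative if $\bigl(\bigcap_{i\in\Delta}s_iR\bigr)\cap S\neq\varnothing$ for every family $(s_i)_{i\in\Delta}$ of elements of $S$. *)

theory Defs
  imports "HOL-Algebra.Algebra"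
begin

definition multiplicative_set :: "('a, 'm) ring_scheme \<Rightarrow> 'a set \<Rightarrow> bool" where
  "multiplicative_set R S \<longleftrightarrow>
     S \<subseteq> carrier R \<and> \<zero>\<^bsub>R\<^esub> \<notin> S \<and> \<one>\<^bsub>R\<^esub> \<in> S \<and>
     (\<forall>s\<in>S. \<forall>t\<in>S. s \<otimes>\<^bsub>R\<^esub> t \<in> S)"

(* HOL cannot quantify over the type of the index set, so families are indexed by sets of
   elements of the ambient type; strongly_multiplicative_family below shows that this covers
   families over every index type.  The empty intersection is UNIV instead of the carrier,
   which makes no difference as it is intersected with S. *)
definition strongly_multiplicative_set :: "('a, 'm) ring_scheme \<Rightarrow> 'a set \<Rightarrow> bool" where
  "strongly_multiplicative_set R S \<longleftrightarrow>
     multiplicative_set R S \<and>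
     (\<forall>(\<Delta> :: 'a set) (s :: 'a \<Rightarrow> 'a). (\<forall>i\<in>\<Delta>. s i \<in> S) \<longrightarrow>
        (\<Inter>i\<in>\<Delta>. PIdl\<^bsub>R\<^esub> (s i)) \<inter> S \<noteq> {})"

lemma strongly_multiplicative_family:
  fixes s :: "'i \<Rightarrow> 'a" and \<Delta> :: "'i set"
  assumes "strongly_multiplicative_set R S" and "\<forall>i\<in>\<Delta>. s i \<in> S"
  shows "(\<Inter>i\<in>\<Delta>. PIdl\<^bsub>R\<^esub> (s i)) \<inter> S \<noteq> {}"
proof -
  have "\<forall>x\<in>s ` \<Delta>. id x \<in> S"
    using assms(2) by auto
  then have "(\<Inter>x\<in>s ` \<Delta>. PIdl\<^bsub>R\<^esub> (id x)) \<inter> S \<noteq> {}"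
    using assms(1) unfolding strongly_multiplicative_set_def by blast
  then show ?thesis
    by simp
qed

definition amalgamation ::
  "('a, 'm) ring_scheme \<Rightarrow> ('b, 'n) ring_scheme \<Rightarrow> ('a \<Rightarrow> 'b) \<Rightarrow> 'b set \<Rightarrow> ('a \<times> 'b) ring" where
  "amalgamation A B f J =
     (RDirProd A B)\<lparr>carrier := {(a, f a \<oplus>\<^bsub>B\<^esub> j) | a j. a \<in> carrier A \<and> j \<in> J}\<rparr>"

definition amalgamation_lift ::
  "('a, 'm) ring_scheme \<Rightarrow> ('b, 'n) ring_scheme \<Rightarrow> ('a \<Rightarrow> 'b) \<Rightarrow> 'a set \<Rightarrow> ('a \<times> 'b) set" where
  "amalgamation_lift A B f S = {(s, f s) | s. s \<in> S} \<union> {(\<one>\<^bsub>A\<^esub>, \<one>\<^bsub>B\<^esub>)}"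

lemma RDirProd_simps:
  "(a, b) \<otimes>\<^bsub>RDirProd A B\<^esub> (a', b') = (a \<otimes>\<^bsub>A\<^esub> a', b \<otimes>\<^bsub>B\<^esub> b')"
  "(a, b) \<oplus>\<^bsub>RDirProd A B\<^esub> (a', b') = (a \<oplus>\<^bsub>A\<^esub> a', b \<oplus>\<^bsub>B\<^esub> b')"
  "\<one>\<^bsub>RDirProd A B\<^esub> = (\<one>\<^bsub>A\<^esub>, \<one>\<^bsub>B\<^esub>)"
  "\<zero>\<^bsub>RDirProd A B\<^esub> = (\<zero>\<^bsub>A\<^esub>, \<zero>\<^bsub>B\<^esub>)"
  by (simp_all add: RDirProd_def DirProd_def monoid.defs)

lemma amalgamation_subring:
  assumes "cring A" "cring B" "f \<in> ring_hom A B" "ideal J B"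
  shows "subring (carrier (amalgamation A B f J)) (RDirProd A B)"
proof -
  interpret A: cring A by fact
  interpret B: cring B by fact
  interpret J: ideal J B by fact
  interpret f: ring_hom_cring A B f
    using assms(1-3) by (simp add: ring_hom_cring_def ring_hom_cring_axioms_def)
  interpret P: ring "RDirProd A B"
    by (rule RDirProd_ring[OF A.ring_axioms B.ring_axioms])
  let ?H = "{(a, f a \<oplus>\<^bsub>B\<^esub> j) | a j. a \<in> carrier A \<and> j \<in> J}"
  note J_add = additive_subgroup.a_closed[OF J.additive_subgroup_axioms]
  have J_carr: "j \<in> carrier B" if "j \<in> J" for j
    using that J.a_subset by auto
  have "subring ?H (RDirProd A B)"
  proof (rule P.subringI)
    show "?H \<subseteq> carrier (RDirProd A B)"
      by (auto simp: RDirProd_carrier J_carr)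
    show "\<one>\<^bsub>RDirProd A B\<^esub> \<in> ?H"
      using additive_subgroup.zero_closed[OF J.additive_subgroup_axioms]
      by (auto simp: RDirProd_simps intro!: exI[of _ "\<zero>\<^bsub>B\<^esub>"])
  next
    fix h assume "h \<in> ?H"
    then obtain a j where h: "h = (a, f a \<oplus>\<^bsub>B\<^esub> j)" "a \<in> carrier A" "j \<in> J"
      by auto
    let ?k = "(\<ominus>\<^bsub>A\<^esub> a, f (\<ominus>\<^bsub>A\<^esub> a) \<oplus>\<^bsub>B\<^esub> (\<ominus>\<^bsub>B\<^esub> j))"
    have "h \<oplus>\<^bsub>RDirProd A B\<^esub> ?k = \<zero>\<^bsub>RDirProd A B\<^esub>"
      using h J_carr[OF h(3)]
      by (auto simp: RDirProd_simps A.r_neg B.minus_add[symmetric] B.r_neg)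
    moreover have "h \<in> carrier (RDirProd A B)" "?k \<in> carrier (RDirProd A B)"
      using h J_carr[OF h(3)] by (auto simp: RDirProd_carrier)
    ultimately have "\<ominus>\<^bsub>RDirProd A B\<^esub> h = ?k"
      by (metis P.a_comm P.minus_equality)
    then show "\<ominus>\<^bsub>RDirProd A B\<^esub> h \<in> ?H"
      using h by auto
  next
    fix h1 h2 assume "h1 \<in> ?H" "h2 \<in> ?H"
    then obtain a j a' j' where h:
      "h1 = (a, f a \<oplus>\<^bsub>B\<^esub> j)" "a \<in> carrier A" "j \<in> J"
      "h2 = (a', f a' \<oplus>\<^bsub>B\<^esub> j')" "a' \<in> carrier A" "j' \<in> J"
      by auto
    note jc = J_carr[OF h(3)] J_carr[OF h(6)]
    have "h1 \<otimes>\<^bsub>RDirProd A B\<^esub> h2 =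
      (a \<otimes>\<^bsub>A\<^esub> a', f (a \<otimes>\<^bsub>A\<^esub> a') \<oplus>\<^bsub>B\<^esub> (f a \<otimes>\<^bsub>B\<^esub> j' \<oplus>\<^bsub>B\<^esub> j \<otimes>\<^bsub>B\<^esub> (f a' \<oplus>\<^bsub>B\<^esub> j')))"
      using h jc by (simp add: RDirProd_simps B.l_distr B.r_distr B.a_ac)
    moreover have "f a \<otimes>\<^bsub>B\<^esub> j' \<oplus>\<^bsub>B\<^esub> j \<otimes>\<^bsub>B\<^esub> (f a' \<oplus>\<^bsub>B\<^esub> j') \<in> J"
      using h jc by (intro J_add J.I_l_closed J.I_r_closed) auto
    ultimately show "h1 \<otimes>\<^bsub>RDirProd A B\<^esub> h2 \<in> ?H"
      using h by auto
    have "h1 \<oplus>\<^bsub>RDirProd A B\<^esub> h2 = (a \<oplus>\<^bsub>A\<^esub> a', f (a \<oplus>\<^bsub>A\<^esub> a') \<oplus>\<^bsub>B\<^esub> (j \<oplus>\<^bsub>B\<^esub> j'))"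
      using h jc by (simp add: RDirProd_simps B.a_ac)
    then show "h1 \<oplus>\<^bsub>RDirProd A B\<^esub> h2 \<in> ?H"
      using h by (auto intro: J_add)
  qed
  then show ?thesis
    by (simp add: amalgamation_def)
qed

end

(* The graph map a \<mapsto> (a, f a) identifies S with S' and preserves and reflects membership in principal
   ideals: a witness t = x s lifts to (t, f t) = (x, f x) (s, f s), and a witness in the amalgamation
   projects to A by the first coordinate. *)
theory Submission
  imports Defs
begin

lemma amalgamation_carrier:
  "carrier (amalgamation A B f J) = {(a, f a \<oplus>\<^bsub>B\<^esub> j) | a j. a \<in> carrier A \<and> j \<in> J}"
  by (simp add: amalgamation_def)

lemma amalgamation_mult:
  "(a, b) \<otimes>\<^bsub>amalgamation A B f J\<^esub> (a', b') = (a \<otimes>\<^bsub>A\<^esub> a', b \<otimes>\<^bsub>B\<^esub> b')"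
  using RDirProd_simps(1)[of A B] by (simp add: amalgamation_def)

lemma amalgamation_one: "\<one>\<^bsub>amalgamation A B f J\<^esub> = (\<one>\<^bsub>A\<^esub>, \<one>\<^bsub>B\<^esub>)"
  using RDirProd_simps(3)[of A B] by (simp add: amalgamation_def)

lemma amalgamation_zero: "\<zero>\<^bsub>amalgamation A B f J\<^esub> = (\<zero>\<^bsub>A\<^esub>, \<zero>\<^bsub>B\<^esub>)"
  using RDirProd_simps(4)[of A B] by (simp add: amalgamation_def)

text \<open>Graph points are the elements with \<open>j = 0\<close>, and zero lies in every ideal.
  This supplies both the elements of the lifted set and the multipliers needed for principal
  ideals.\<close>

lemma graph_in_amalgamation:
  assumes "ring B" "f \<in> ring_hom A B" "ideal J B" "a \<in> carrier A"
  shows "(a, f a) \<in> carrier (amalgamation A B f J)"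
proof -
  interpret B: ring B by fact
  interpret J: ideal J B by fact
  have "f a = f a \<oplus>\<^bsub>B\<^esub> \<zero>\<^bsub>B\<^esub>"
    using ring_hom_closed[OF assms(2,4)] by simp
  then show ?thesis
    unfolding amalgamation_carrier using assms(4) J.zero_closed by blast
qed

text \<open>The multipliers on the two sides differ: one in the amalgamation has the form
  \<open>(x, f x + j)\<close> with arbitrary \<open>j\<close> in \<open>J\<close>, one in
  \<open>A\<close> is just \<open>x\<close>. Forgetting \<open>j\<close> gives one direction,
  choosing \<open>j = 0\<close> the other.\<close>

lemma graph_in_PIdl_iff:
  assumes "ring B" "f \<in> ring_hom A B" "ideal J B" "s \<in> carrier A"
  shows "(t, f t) \<in> PIdl\<^bsub>amalgamation A B f J\<^esub> (s, f s) \<longleftrightarrow> t \<in> PIdl\<^bsub>A\<^esub> s"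
proof
  assume "(t, f t) \<in> PIdl\<^bsub>amalgamation A B f J\<^esub> (s, f s)"
  then show "t \<in> PIdl\<^bsub>A\<^esub> s"
    \<comment> \<open>Multiplication is componentwise, so the first coordinate of the multiplier
      already exhibits \<open>t\<close> as a multiple of \<open>s\<close>.\<close>
    by (auto simp: cgenideal_def amalgamation_carrier amalgamation_mult)
next
  assume "t \<in> PIdl\<^bsub>A\<^esub> s"
  then obtain x where x: "x \<in> carrier A" "t = x \<otimes>\<^bsub>A\<^esub> s"
    by (auto simp: cgenideal_def)
  then have "(t, f t) = (x, f x) \<otimes>\<^bsub>amalgamation A B f J\<^esub> (s, f s)"
    using ring_hom_mult[OF assms(2)] assms(4) by (simp add: amalgamation_mult)
  then show "(t, f t) \<in> PIdl\<^bsub>amalgamation A B f J\<^esub> (s, f s)"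
    using graph_in_amalgamation[OF assms(1-3) x(1)] unfolding cgenideal_def by blast
qed

text \<open>The adjoined pair is the graph point over \<open>\<one>\<close>, because
  \<open>f\<close> preserves one and \<open>S\<close> contains it.\<close>

lemma amalgamation_lift_eq_image:
  assumes "f \<in> ring_hom A B" "\<one>\<^bsub>A\<^esub> \<in> S"
  shows "amalgamation_lift A B f S = (\<lambda>s. (s, f s)) ` S"
  using assms(2) ring_hom_one[OF assms(1)] by (auto simp: amalgamation_lift_def)

text \<open>Closure under products comes from multiplicativity of \<open>f\<close>; zero is avoided
  because the first coordinate of a lifted element lies in \<open>S\<close>.\<close>

lemma multiplicative_set_amalgamation_lift:
  assumes "ring B" "f \<in> ring_hom A B" "ideal J B" "multiplicative_set A S"
  shows "multiplicative_set (amalgamation A B f J) (amalgamation_lift A B f S)"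
proof -
  have S: "S \<subseteq> carrier A" "\<zero>\<^bsub>A\<^esub> \<notin> S" "\<one>\<^bsub>A\<^esub> \<in> S" "\<And>s t. s \<in> S \<Longrightarrow> t \<in> S \<Longrightarrow> s \<otimes>\<^bsub>A\<^esub> t \<in> S"
    using assms(4) by (auto simp: multiplicative_set_def)
  have "f (s \<otimes>\<^bsub>A\<^esub> t) = f s \<otimes>\<^bsub>B\<^esub> f t" if "s \<in> S" "t \<in> S" for s t
    using ring_hom_mult[OF assms(2)] that S(1) by blast
  moreover have "(s, f s) \<in> carrier (amalgamation A B f J)" if "s \<in> S" for s
    using graph_in_amalgamation[OF assms(1-3)] that S(1) by blast
  ultimately show ?thesis
    using S(2-4) ring_hom_one[OF assms(2)]
    unfolding multiplicative_set_def amalgamation_lift_eq_image[OF assms(2) S(3)]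
    by (auto simp: amalgamation_mult amalgamation_one amalgamation_zero)
qed

theorem theorem2p20:
  fixes A :: "('a, 'm) ring_scheme" and B :: "('b, 'n) ring_scheme"
    and f :: "'a \<Rightarrow> 'b" and J :: "'b set" and S :: "'a set"
  assumes "cring A" and "\<one>\<^bsub>A\<^esub> \<noteq> \<zero>\<^bsub>A\<^esub>"
    and "cring B" and "\<one>\<^bsub>B\<^esub> \<noteq> \<zero>\<^bsub>B\<^esub>"
    and "f \<in> ring_hom A B"
    and "ideal J B"
    and "multiplicative_set A S"
  shows "strongly_multiplicative_set (amalgamation A B f J) (amalgamation_lift A B f S)
         \<longleftrightarrow> strongly_multiplicative_set A S"
proof -
  let ?C = "amalgamation A B f J"
  let ?T = "amalgamation_lift A B f S"
  have B: "ring B"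
    using assms(3) by (rule cring.axioms)
  have S: "S \<subseteq> carrier A" "\<one>\<^bsub>A\<^esub> \<in> S"
    using assms(7) by (auto simp: multiplicative_set_def)
  note T = amalgamation_lift_eq_image[OF assms(5) S(2)]
  have PIdl: "(t, f t) \<in> PIdl\<^bsub>?C\<^esub> (s, f s) \<longleftrightarrow> t \<in> PIdl\<^bsub>A\<^esub> s" if "s \<in> S" for s t
    using graph_in_PIdl_iff[OF B assms(5,6)] that S(1) by blast
  show ?thesis
  proof
    assume C: "strongly_multiplicative_set ?C ?T"
    have "(\<Inter>i\<in>\<Delta>. PIdl\<^bsub>A\<^esub> (s i)) \<inter> S \<noteq> {}" if s: "\<forall>i\<in>\<Delta>. s i \<in> S"
      for \<Delta> :: "'a set" and s
    proof -
      have "\<forall>i\<in>\<Delta>. (s i, f (s i)) \<in> ?T"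
        using s T by blast
      \<comment> \<open>The indices have type \<open>'a\<close>, whereas the definition over
        \<open>?C\<close> indexes families by pairs; the version for arbitrary index types bridges
        this.\<close>
      from strongly_multiplicative_family[OF C this]
      obtain t where "t \<in> S" "\<forall>i\<in>\<Delta>. (t, f t) \<in> PIdl\<^bsub>?C\<^esub> (s i, f (s i))"
        unfolding T by blast
      then show ?thesis
        using PIdl s by blast
    qed
    then show "strongly_multiplicative_set A S"
      using assms(7) by (simp add: strongly_multiplicative_set_def)
  next
    assume A: "strongly_multiplicative_set A S"
    have "(\<Inter>i\<in>\<Delta>. PIdl\<^bsub>?C\<^esub> (s i)) \<inter> ?T \<noteq> {}" if s: "\<forall>i\<in>\<Delta>. s i \<in> ?T"
      for \<Delta> :: "('a \<times> 'b) set" and s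
    proof -
      \<comment> \<open>Each member of \<open>?T\<close> is determined by its first coordinate, so
        the given family descends to one in \<open>S\<close>, still indexed by pairs.\<close>
      have u: "\<forall>i\<in>\<Delta>. fst (s i) \<in> S" and s_eq: "\<forall>i\<in>\<Delta>. s i = (fst (s i), f (fst (s i)))"
        using s unfolding T by auto
      from strongly_multiplicative_family[OF A u]
      obtain t where t: "t \<in> S" "\<forall>i\<in>\<Delta>. t \<in> PIdl\<^bsub>A\<^esub> (fst (s i))"
        by blast
      \<comment> \<open>The common multiple \<open>t\<close> found in \<open>A\<close> is lifted to
        the graph, which puts it in \<open>?T\<close>.\<close>
      have "(t, f t) \<in> PIdl\<^bsub>?C\<^esub> (s i)" if "i \<in> \<Delta>" for i
        using PIdl u t(2) s_eq that by metis
      then show ?thesis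
        using t(1) unfolding T by blast
    qed
    then show "strongly_multiplicative_set ?C ?T"
      using multiplicative_set_amalgamation_lift[OF B assms(5-7)]
      by (simp add: strongly_multiplicative_set_def)
  qed
qed

end
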